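(* Let $W$ be a standard Brownian motion on $[0,T]$, $n\ge 1$, $0=t_0\le t_1\le\cdots\le t_n=T$, and, for $i\ge1$, let $$e_i^W(t)=\sqrt{\tfrac2T}\,\sin\Big(\pi\big(i-\tfrac12\big)\tfrac tT\Big),\qquad\lambda_i^W=\Big(\frac{T}{\pi(i-1/2)}\Big)^2 .$$ Then for every $i\ge1$, $$\mathbb{E}\Big[\int_0^TW_se_i^W(s)\,ds\,\Big|\,W_{t_0},\dots,W_{t_n}\Big]=\sum_{j=0}^n\alpha_{ij}W_{t_j}\quad\text{a.s.},$$ where, for $1\le j<n$: - if $t_{j-1}<t_j<t_{j+1}$, $\ \alpha_{ij}=\lambda_i^W\,\dfrac{(t_{j+1}-t_{j-1})e_i^W(t_j)-(t_{j+1}-t_j)e_i^W(t_{j-1})-(t_j-t_{j-1})e_i^W(t_{j+1})}{(t_{j+1}-t_j)(t_j-t_{j-1})}$; - if $t_{j-1}=t_j<t_{j+1}$, $\ \alpha_{ij}=\lambda_i^W\Big((e_i^W)'(t_j)-\dfrac{e_i^W(t_{j+1})-e_i^W(t_j)}{t_{j+1}-t_j}\Big)$; - if $t_{j-1}<t_j=t_{j+1}$, $\ \alpha_{ij}=\lambda_i^W\Big(\dfrac{e_i^W(t_j)-e_i^W(t_{j-1})}{t_j-t_{j-1}}-(e_i^W)'(t_j)\Big)$; - if $t_{j-1}=t_j=t_{j+1}$, $\ \alpha_{ij}=0$; and $$\alpha_{i0}=\lambda_i^W\Big((e_i^W)'(t_0)-\frac{e_i^W(t_1)-e_i^W(t_0)}{t_1-t_0}\Big)\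 \text{if }t_1\ne t_0,\quad\alpha_{i0}=0\ \text{otherwise},$$ $$\alpha_{in}=\lambda_i^W\Big(\frac{e_i^W(t_n)-e_i^W(t_{n-1})}{t_n-t_{n-1}}-(e_i^W)'(t_n)\Big)\ \text{if }t_n\ne t_{n-1},\quad\alpha_{in}=0\ \text{otherwise}.$$
   Context: $(e_i^W,\lambda_i^W)_{i\ge1}$ is the Karhunen-Loève eigensystem of Brownian motion on $[0,T]$. *)

theory Defs
  imports "HOL-Probability.Probability"
begin

text \<open>
  The paths are required to be continuous for every \<open>\<omega>\<close>, not only almost surely: on a probability
  space that is not complete, this is what makes path integrals measurable.
\<close>

locale standard_brownian_motion = prob_space M
  for M :: "'a measure" and T :: real and W :: "real \<Rightarrow> 'a \<Rightarrow> real" +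
  assumes measurable_W: "\<And>s. s \<in> {0..T} \<Longrightarrow> W s \<in> borel_measurable M"
    and start_zero: "AE \<omega> in M. W 0 \<omega> = 0"
    and indep_increments:
      "\<And>(m::nat) (s::nat \<Rightarrow> real).
        (\<And>k. k \<le> m \<Longrightarrow> s k \<in> {0..T}) \<Longrightarrow> (\<And>k. k < m \<Longrightarrow> s k \<le> s (Suc k)) \<Longrightarrow>
        indep_vars (\<lambda>_. borel) (\<lambda>k \<omega>. W (s (Suc k)) \<omega> - W (s k) \<omega>) {..<m}"
    and normal_increments:
      "\<And>r s. 0 \<le> r \<Longrightarrow> r < s \<Longrightarrow> s \<le> T \<Longrightarrow>
        distributed M lborel (\<lambda>\<omega>. W s \<omega> - W r \<omega>) (normal_density 0 (sqrt (s - r)))"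
    and continuous_paths: "\<And>\<omega>. \<omega> \<in> space M \<Longrightarrow> continuous_on {0..T} (\<lambda>s. W s \<omega>)"

definition eigfun_W :: "real \<Rightarrow> nat \<Rightarrow> real \<Rightarrow> real" where
  "eigfun_W T i s = sqrt (2 / T) * sin (pi * (real i - 1 / 2) * (s / T))"

definition eigval_W :: "real \<Rightarrow> nat \<Rightarrow> real" where
  "eigval_W T i = (T / (pi * (real i - 1 / 2)))\<^sup>2"

definition sigma_observations ::
  "'a measure \<Rightarrow> (real \<Rightarrow> 'a \<Rightarrow> real) \<Rightarrow> (nat \<Rightarrow> real) \<Rightarrow> nat \<Rightarrow> 'a measure" where
  "sigma_observations M W t n =
     vimage_algebra (space M) (\<lambda>\<omega>. \<lambda>j\<in>{0..n}. W (t j) \<omega>) (Pi\<^sub>M {0..n} (\<lambda>_. borel))"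

definition alpha_W :: "real \<Rightarrow> nat \<Rightarrow> (nat \<Rightarrow> real) \<Rightarrow> nat \<Rightarrow> nat \<Rightarrow> real" where
  "alpha_W T n t i j =
    (let e = eigfun_W T i; l = eigval_W T i in
     if j = 0 then
       (if t 1 \<noteq> t 0 then l * (deriv e (t 0) - (e (t 1) - e (t 0)) / (t 1 - t 0)) else 0)
     else if j = n then
       (if t n \<noteq> t (n - 1)
        then l * ((e (t n) - e (t (n - 1))) / (t n - t (n - 1)) - deriv e (t n)) else 0)
     else if t (j - 1) < t j \<and> t j < t (j + 1) then
       l * (((t (j + 1) - t (j - 1)) * e (t j) - (t (j + 1) - t j) * e (t (j - 1))
             - (t j - t (j - 1)) * e (t (j + 1)))
            / ((t (j + 1) - t j) * (t j - t (j - 1))))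
     else if t (j - 1) = t j \<and> t j < t (j + 1) then
       l * (deriv e (t j) - (e (t (j + 1)) - e (t j)) / (t (j + 1) - t j))
     else if t (j - 1) < t j \<and> t j = t (j + 1) then
       l * ((e (t j) - e (t (j - 1))) / (t j - t (j - 1)) - deriv e (t j))
     else 0)"

end

theory Submission
  imports Defs
begin

text \<open>
  Write \<open>e\<close> for the eigenfunction and \<open>\<lambda>\<close> for its eigenvalue, and fix an event \<open>A\<close> of the
  \<open>\<sigma>\<close>-algebra generated by the observations. The proof reduces the theorem to a fact about the
  single real function \<open>w s = E[1\<^sub>A W\<^sub>s]\<close>.

  Between two consecutive observation times \<open>a < b\<close>, the deviation of \<open>W\<^sub>s\<close> from the linear
  interpolation of \<open>W\<^sub>a\<close> and \<open>W\<^sub>b\<close> is a Brownian bridge. Up to the factor \<open>b - a\<close> it is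
  \<open>(b - s) X - (s - a) Y\<close> with the independent increments \<open>X = W\<^sub>s - W\<^sub>a\<close> and \<open>Y = W\<^sub>b - W\<^sub>s\<close>, and
  the observations carry no information on it beyond \<open>X + Y\<close> and increments independent of
  \<open>(X, Y)\<close>. The variances \<open>s - a\<close> and \<open>b - s\<close> make the bridge centred given \<open>X + Y\<close>
  (\<open>gaussian_bridge_centred_on_sum\<close>), and independence allows conditioning on the other
  increments as well (\<open>centred_given_independent\<close>). Hence \<open>w\<close> is affine between consecutive
  observation times (\<open>brownian_bridge_centred_given_observations\<close>).

  Since \<open>e = - \<lambda> e''\<close>, two integrations by parts evaluate the integral of \<open>w e\<close> over each gap
  from the values of \<open>w\<close> at its two ends. The coefficients \<open>\<alpha>\<close> collect, at each observation
  time, the contribution of the gap to its right and that of the gap to its left, a gap of length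
  zero contributing nothing; so the integral of \<open>w e\<close> over \<open>[0, T]\<close> is \<open>\<Sum>\<^sub>j \<alpha>\<^sub>j w(t\<^sub>j)\<close>
  (\<open>alpha_W_quadrature\<close>). By Fubini (\<open>path_integral_Fubini\<close>) that integral is
  \<open>E[1\<^sub>A \<integral> W\<^sub>s e(s) ds]\<close>, while \<open>\<Sum>\<^sub>j \<alpha>\<^sub>j w(t\<^sub>j)\<close> is \<open>E[1\<^sub>A \<Sum>\<^sub>j \<alpha>\<^sub>j W(t\<^sub>j)]\<close>. As \<open>A\<close> is arbitrary, this
  characterises the conditional expectation.
\<close>

section \<open>Centring a Gaussian bridge\<close>

text \<open>
  Completing the square: if \<open>X\<close> and \<open>Y\<close> are independent centred normal variables with variances
  \<open>u\<close> and \<open>v\<close>, the left-hand side is the joint density of \<open>X\<close> and \<open>X + Y\<close>, and the right-hand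
  side disintegrates it into the law of the sum and the conditional law of \<open>X\<close> given the sum.
\<close>
lemma normal_density_shear:
  assumes "u > 0" "v > 0"
  shows "normal_density 0 (sqrt u) x * normal_density 0 (sqrt v) (z - x)
    = normal_density 0 (sqrt (u + v)) z
      * normal_density (u * z / (u + v)) (sqrt (u * v / (u + v))) x"
proof -
  have "u + v > 0"
    using assms by simp
  have roots: "sqrt (2 * pi * (u + v)) * sqrt (2 * pi * (u * v) / (u + v))
      = sqrt (2 * pi * u) * sqrt (2 * pi * v)"
    using assms by (subst power_eq_iff_eq_base[symmetric, where n=2])
      (simp_all add: real_sqrt_mult[symmetric] power2_eq_square)
  have exponents: "x\<^sup>2 / (2 * u) + (z - x)\<^sup>2 / (2 * v)
      = z\<^sup>2 / (2 * (u + v)) + (x - u * z / (u + v))\<^sup>2 / (2 * (u * v / (u + v)))"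
    using assms \<open>u + v > 0\<close>
    by (simp add: divide_simps power2_eq_square) (simp add: algebra_simps)
  have "exp (- (x\<^sup>2 / (2 * u))) * exp (- ((z - x)\<^sup>2 / (2 * v)))
      = exp (- (z\<^sup>2 / (2 * (u + v)))) * exp (- ((x - u * z / (u + v))\<^sup>2 / (2 * (u * v / (u + v)))))"
    unfolding mult_exp_exp using exponents by (intro arg_cong[where f=exp]) linarith
  then show ?thesis
    using assms roots by (simp add: normal_density_def field_simps)
qed

text \<open>
  The weights match the conditional mean \<open>u z / (u + v)\<close> of the first variable, so the
  integral is a first central moment of a normal law.
\<close>
lemma bridge_kernel_centred:
  assumes "u > 0" "v > 0"
  shows "(\<integral>x. (v * x - u * (z - x))
      * (normal_density 0 (sqrt u) x * normal_density 0 (sqrt v) (z - x)) \<partial>lborel) = 0"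
proof -
  let ?\<mu> = "u * z / (u + v)" and ?\<sigma> = "sqrt (u * v / (u + v))"
  have "v * x - u * (z - x) = (u + v) * (x - ?\<mu>)" for x
    using assms by (simp add: field_simps)
  then have "(\<integral>x. (v * x - u * (z - x))
      * (normal_density 0 (sqrt u) x * normal_density 0 (sqrt v) (z - x)) \<partial>lborel)
    = (\<integral>x. ((u + v) * normal_density 0 (sqrt (u + v)) z)
      * (normal_density ?\<mu> ?\<sigma> x * (x - ?\<mu>) ^ (2 * 0 + 1)) \<partial>lborel)"
    unfolding normal_density_shear[OF assms] by (intro Bochner_Integration.integral_cong) (auto simp: mult_ac)
  also have "\<dots> = 0"
    unfolding integral_mult_right_zero using assms
    by (subst integral_normal_moment_odd) auto
  finally show ?thesis .
qed

lemma (in prob_space) centred_normal_first_moments: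
  assumes "distributed M lborel X (normal_density 0 \<sigma>)" "\<sigma> > 0"
  shows "integrable M X" "(\<integral>\<omega>. \<bar>X \<omega>\<bar> \<partial>M) = \<sigma> * sqrt (2 / pi)"
proof -
  have "integrable lborel (\<lambda>x. normal_density 0 \<sigma> x * x)"
    using integrable_normal_moment_nz_1[OF assms(2), of 0] .
  then show "integrable M X"
    using distributed_integrable[OF assms(1), of "\<lambda>x. x"] by simp
  show "(\<integral>\<omega>. \<bar>X \<omega>\<bar> \<partial>M) = \<sigma> * sqrt (2 / pi)"
    using distributed_integral[OF assms(1), of "\<lambda>x. \<bar>x\<bar>"] integral_normal_moment_abs_odd[OF assms(2), of 0 0]
    by simp
qed

text \<open>
  \<open>v X - u Y\<close> and \<open>X + Y\<close> are uncorrelated and jointly Gaussian, so that the bridge is even independent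
  of the sum. Only its conditional mean matters below, and this is obtained directly: the shear
  \<open>(x, y) \<mapsto> (x, x + y)\<close> turns the sum into a coordinate, along which the indicator is constant.
\<close>
lemma (in prob_space) gaussian_bridge_centred_on_sum:
  assumes indep: "indep_var borel X borel Y" and uv: "u > 0" "v > 0"
    and X: "distributed M lborel X (normal_density 0 (sqrt u))"
    and Y: "distributed M lborel Y (normal_density 0 (sqrt v))"
    and [measurable]: "B \<in> sets borel"
  shows "(\<integral>\<omega>. (v * X \<omega> - u * Y \<omega>) * indicator B (X \<omega> + Y \<omega>) \<partial>M) = 0"
proof -
  let ?f = "normal_density 0 (sqrt u)" and ?g = "normal_density 0 (sqrt v)"
  define F where "F x y = (v * x - u * y) * indicator B (x + y) * (?f x * ?g y)" for x y :: real
  have F[measurable]: "case_prod F \<in> borel_measurable (borel \<Otimes>\<^sub>M borel)"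
    unfolding F_def by measurable
  have "indep_var lborel X lborel Y"
    using indep by (simp add: indep_var_eq)
  have h[measurable]: "(\<lambda>(x, y). (v * x - u * y) * indicator B (x + y)) \<in> borel_measurable (lborel \<Otimes>\<^sub>M lborel)"
    by measurable
  have XY': "distributed M (lborel \<Otimes>\<^sub>M lborel) (\<lambda>\<omega>. (X \<omega>, Y \<omega>)) (\<lambda>p. ennreal (case p of (x, y) \<Rightarrow> ?f x * ?g y))"
    using distributed_joint_indep[OF lborel.sigma_finite_measure_axioms
        lborel.sigma_finite_measure_axioms X Y]
    by (simp add: \<open>indep_var lborel X lborel Y\<close> ennreal_mult'[symmetric] case_prod_beta')
  have [measurable]: "integrable M X" "integrable M Y"
    using centred_normal_first_moments(1) X Y uv by auto
  have "integrable M (\<lambda>\<omega>. v * X \<omega> - u * Y \<omega>)"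
    by (simp add: \<open>integrable M X\<close> \<open>integrable M Y\<close>)
  then have "integrable M (\<lambda>\<omega>. (v * X \<omega> - u * Y \<omega>) * indicator B (X \<omega> + Y \<omega>))"
    by (rule Bochner_Integration.integrable_bound) (auto split: split_indicator)
  then have F_int: "integrable (lborel \<Otimes>\<^sub>M lborel) (case_prod F)"
    using distributed_integrable[OF XY' h] by (simp add: F_def case_prod_beta' mult_ac)
  have E_F: "(\<integral>\<omega>. (v * X \<omega> - u * Y \<omega>) * indicator B (X \<omega> + Y \<omega>) \<partial>M)
    = (\<integral>p. case_prod F p \<partial>(lborel \<Otimes>\<^sub>M lborel))"
    using distributed_integral[OF XY' h] by (simp add: F_def case_prod_beta' mult_ac)
  \<comment> \<open>Sheared slices have the same integrals as the original ones by translation invariance, so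
    that integrability passes to the sheared integrand slice by slice.\<close>
  have shear_int: "integrable (lborel \<Otimes>\<^sub>M lborel) (\<lambda>(x, z). F x (z - x))"
  proof (rule lborel_pair.Fubini_integrable)
    show "(\<lambda>(x, z). F x (z - x)) \<in> borel_measurable (lborel \<Otimes>\<^sub>M lborel)"
      unfolding F_def by measurable
    have "(\<integral>z. norm (F x (z - x)) \<partial>lborel) = (\<integral>y. norm (F x y) \<partial>lborel)" for x
      using lborel_integral_real_affine[of 1 "\<lambda>y. norm (F x y)" "- x"] by simp
    then show "integrable lborel (\<lambda>x. \<integral>z. norm (case (x, z) of (x, z) \<Rightarrow> F x (z - x)) \<partial>lborel)"
      using lborel_pair.integrable_fst'[OF integrable_norm[OF F_int]] by simp
    show "AE x in lborel. integrable lborel (\<lambda>z. case (x, z) of (x, z) \<Rightarrow> F x (z - x))"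
      using lborel_pair.AE_integrable_fst'[OF F_int]
    proof eventually_elim
      case (elim x)
      then show ?case
        using lborel_integrable_real_affine[of "F x" 1 "- x"] by simp
    qed
  qed
  have "(\<integral>p. case_prod F p \<partial>(lborel \<Otimes>\<^sub>M lborel)) = (\<integral>x. (\<integral>y. F x y \<partial>lborel) \<partial>lborel)"
    using lborel_pair.integral_fst'[OF F_int] by simp
  also have "\<dots> = (\<integral>x. (\<integral>z. F x (z - x) \<partial>lborel) \<partial>lborel)"
  proof (rule Bochner_Integration.integral_cong[OF refl])
    show "(\<integral>y. F x y \<partial>lborel) = (\<integral>z. F x (z - x) \<partial>lborel)" for x
      using lborel_integral_real_affine[of 1 "F x" "- x"] by simp
  qed
  also have "\<dots> = (\<integral>z. (\<integral>x. F x (z - x) \<partial>lborel) \<partial>lborel)"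
    using lborel_pair.Fubini_integral[OF shear_int] by simp
  also have "\<dots> = 0"
  proof -
    have "(\<integral>x. F x (z - x) \<partial>lborel) = 0" for z
    proof -
      have "(\<integral>x. F x (z - x) \<partial>lborel) = (\<integral>x. indicator B z * ((v * x - u * (z - x)) * (?f x * ?g (z - x))) \<partial>lborel)"
        by (intro Bochner_Integration.integral_cong) (auto simp: F_def)
      then show ?thesis
        using bridge_kernel_centred[OF uv] by simp
    qed
    then show ?thesis by simp
  qed
  finally show ?thesis
    using E_F by simp
qed

text \<open>
  Variables independent of the pair \<open>(f V, g V)\<close> can be frozen by Fubini, so they do not
  disturb the property of \<open>f V\<close> being centred given \<open>g V\<close>.
\<close>
lemma (in prob_space) centred_given_independent:
  fixes f g :: "'b \<Rightarrow> real"
  assumes indep: "indep_var L V N Z"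
    and f[measurable]: "f \<in> borel_measurable L" and g[measurable]: "g \<in> borel_measurable L"
    and int: "integrable M (\<lambda>\<omega>. f (V \<omega>))"
    and centred: "\<And>B. B \<in> sets borel \<Longrightarrow> (\<integral>\<omega>. f (V \<omega>) * indicator B (g (V \<omega>)) \<partial>M) = 0"
    and C[measurable]: "C \<in> sets (borel \<Otimes>\<^sub>M N)"
  shows "(\<integral>\<omega>. f (V \<omega>) * indicator C (g (V \<omega>), Z \<omega>) \<partial>M) = 0"
proof -
  let ?P = "distr M L V" and ?Q = "distr M N Z"
  have V[measurable]: "V \<in> measurable M L" and Z[measurable]: "Z \<in> measurable M N"
    using indep_var_rv1[OF indep] indep_var_rv2[OF indep] by auto
  have joint: "?P \<Otimes>\<^sub>M ?Q = distr M (L \<Otimes>\<^sub>M N) (\<lambda>\<omega>. (V \<omega>, Z \<omega>))"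
    using indep by (simp add: indep_var_distribution_eq)
  interpret P: prob_space ?P by (rule prob_space_distr) fact
  interpret Q: prob_space ?Q by (rule prob_space_distr) fact
  interpret PQ: pair_prob_space ?P ?Q ..
  define G :: "'b \<Rightarrow> 'b \<Rightarrow> real" where "G p z = f p * indicator C (g p, z)" for p z
  have G[measurable]: "case_prod G \<in> borel_measurable (L \<Otimes>\<^sub>M N)"
    unfolding G_def by measurable
  have "integrable M (\<lambda>\<omega>. f (V \<omega>) * indicator C (g (V \<omega>), Z \<omega>))"
    using int by (rule Bochner_Integration.integrable_bound) (auto split: split_indicator)
  then have "integrable (?P \<Otimes>\<^sub>M ?Q) (case_prod G)"
    unfolding joint by (subst integrable_distr_eq) (auto simp: G_def)
  then have "(\<integral>z. (\<integral>p. G p z \<partial>?P) \<partial>?Q) = (\<integral>p. case_prod G p \<partial>(?P \<Otimes>\<^sub>M ?Q))"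
    by (rule PQ.integral_snd)
  also have "\<dots> = (\<integral>\<omega>. f (V \<omega>) * indicator C (g (V \<omega>), Z \<omega>) \<partial>M)"
    unfolding joint by (subst integral_distr) (auto simp: G_def)
  finally have "(\<integral>\<omega>. f (V \<omega>) * indicator C (g (V \<omega>), Z \<omega>) \<partial>M) = (\<integral>z. (\<integral>p. G p z \<partial>?P) \<partial>?Q)" ..
  also have "\<dots> = (\<integral>z. 0 \<partial>?Q)"
  proof (intro Bochner_Integration.integral_cong refl)
    fix z assume "z \<in> space ?Q"
    then have z[measurable]: "z \<in> space N" by simp
    have slice: "(\<lambda>s. (s, z)) -` C \<in> sets borel"
      using measurable_sets[OF measurable_Pair2'[OF z] C] by simp
    have "(\<integral>p. G p z \<partial>?P) = (\<integral>\<omega>. f (V \<omega>) * indicator C (g (V \<omega>), z) \<partial>M)"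
      using z by (subst integral_distr) (auto simp: G_def)
    also have "\<dots> = (\<integral>\<omega>. f (V \<omega>) * indicator ((\<lambda>s. (s, z)) -` C) (g (V \<omega>)) \<partial>M)"
      by (simp add: indicator_def)
    finally show "(\<integral>p. G p z \<partial>?P) = 0"
      using centred[OF slice] by simp
  qed
  finally show ?thesis by simp
qed

section \<open>Exact quadrature for piecewise affine functions\<close>

text \<open>
  Two integrations by parts: since \<open>e = - l e''\<close> and the second derivative of the affine function
  \<open>w\<close> vanishes, \<open>l (w' e - w e')\<close> is an antiderivative of \<open>w e\<close>.
\<close>
lemma has_integral_affine_times_eigenfunction:
  fixes e d w :: "real \<Rightarrow> real"
  assumes ab: "a < b" and l: "l \<noteq> 0"
    and e: "\<And>s. (e has_real_derivative d s) (at s)"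
    and d: "\<And>s. (d has_real_derivative - e s / l) (at s)"
    and w: "\<And>s. s \<in> {a..b} \<Longrightarrow> (b - a) * w s = (b - s) * w a + (s - a) * w b"
  shows "((\<lambda>s. w s * e s) has_integral
    l * (w a * (d a - (e b - e a) / (b - a)) + w b * ((e b - e a) / (b - a) - d b))) {a..b}"
proof -
  define q where "q = (w b - w a) / (b - a)"
  define L where "L s = w a + q * (s - a)" for s
  define F where "F s = l * (q * e s - L s * d s)" for s
  have "(F has_real_derivative L s * e s) (at s)" for s
    unfolding F_def L_def by (rule derivative_eq_intros e d refl)+ (use l in \<open>simp add: field_simps\<close>)
  then have "((\<lambda>s. L s * e s) has_integral F b - F a) {a..b}"
    using ab by (intro fundamental_theorem_of_calculus)
      (auto simp flip: has_real_derivative_iff_has_vector_derivative intro: DERIV_subset)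
  moreover have "L s = w s" if "s \<in> {a..b}" for s
    using w[OF that] ab by (simp add: L_def q_def field_simps)
  ultimately have "((\<lambda>s. w s * e s) has_integral F b - F a) {a..b}"
    by (subst has_integral_cong[where g = "\<lambda>s. L s * e s"]) auto
  moreover have "F b - F a = l * (w a * (d a - m) + w b * (m - d b))" if "m = (e b - e a) / (b - a)" for m
  proof -
    have "L a = w a" "L b = w b" and q: "q * (e b - e a) = (w b - w a) * m"
      using ab that by (simp_all add: L_def q_def)
    then have "F b - F a = l * (q * (e b - e a) - w b * d b + w a * d a)"
      by (simp add: F_def algebra_simps)
    then show ?thesis
      unfolding q by (simp add: algebra_simps)
  qed
  ultimately show ?thesis by simp
qed

lemma has_integral_consecutive_intervals:
  fixes t :: "nat \<Rightarrow> real" and f :: "real \<Rightarrow> real"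
  assumes "\<And>k. k < m \<Longrightarrow> t k \<le> t (Suc k)"
    and "\<And>k. k < m \<Longrightarrow> (f has_integral c k) {t k..t (Suc k)}"
  shows "(f has_integral (\<Sum>k<m. c k)) {t 0..t m}"
  using assms
proof (induction m)
  case 0
  then show ?case by (simp add: has_integral_refl(2))
next
  case (Suc m)
  have "t 0 \<le> t m"
    using Suc.prems(1) by (intro lift_Suc_mono_le[of "\<lambda>k. t (min k m)" 0 m, simplified])
      (auto simp: min_def le_Suc_eq not_less_eq_eq)
  then show ?case
    using Suc by (auto intro!: has_integral_combine[of _ "t m"])
qed

lemma eigfun_W_derivatives:
  "(eigfun_W T i has_real_derivative deriv (eigfun_W T i) s) (at s)"
  "T > 0 \<Longrightarrow> i \<ge> 1 \<Longrightarrow>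
    (deriv (eigfun_W T i) has_real_derivative - eigfun_W T i s / eigval_W T i) (at s)"
proof -
  define c where "c = pi * (real i - 1 / 2) / T"
  have e: "eigfun_W T i = (\<lambda>s. sqrt (2 / T) * sin (c * s))"
    by (auto simp: eigfun_W_def c_def)
  have D: "(eigfun_W T i has_real_derivative sqrt (2 / T) * (c * cos (c * s))) (at s)" for s
    unfolding e by (auto intro!: derivative_eq_intros)
  then show "(eigfun_W T i has_real_derivative deriv (eigfun_W T i) s) (at s)"
    using DERIV_imp_deriv by metis
  have d: "deriv (eigfun_W T i) = (\<lambda>s. sqrt (2 / T) * (c * cos (c * s)))"
    using DERIV_imp_deriv[OF D] by auto
  assume "T > 0" "i \<ge> 1"
  then have "1 / eigval_W T i = c\<^sup>2"
    by (simp add: eigval_W_def c_def power_divide)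
  then have "- eigfun_W T i s / eigval_W T i = - (sqrt (2 / T) * (c * (c * sin (c * s))))"
    unfolding e by (simp add: divide_inverse power2_eq_square mult_ac)
  then show "(deriv (eigfun_W T i) has_real_derivative - eigfun_W T i s / eigval_W T i) (at s)"
    unfolding d by (auto intro!: derivative_eq_intros)
qed

text \<open>
  This explains the case distinctions in the coefficients: a gap of positive length contributes
  \<open>R\<close> to the coefficient at its left end and \<open>L\<close> to the one at its right end, and every coefficient
  is the sum of the contributions of its neighbouring gaps. Where two such gaps meet,
  the two values of the derivative of \<open>e\<close> cancel.
\<close>
lemma alpha_W_quadrature:
  fixes w :: "real \<Rightarrow> real"
  assumes T: "T > 0" and i: "i \<ge> 1" and n: "n \<ge> 1"
    and t: "t 0 = 0" "t n = T" "\<And>k. k < n \<Longrightarrow> t k \<le> t (k + 1)"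
    and w: "\<And>k s. k < n \<Longrightarrow> s \<in> {t k..t (k + 1)} \<Longrightarrow>
      (t (k + 1) - t k) * w s = (t (k + 1) - s) * w (t k) + (s - t k) * w (t (k + 1))"
  shows "((\<lambda>s. w s * eigfun_W T i s) has_integral (\<Sum>j=0..n. alpha_W T n t i j * w (t j))) {0..T}"
proof -
  define e where "e = eigfun_W T i"
  define l where "l = eigval_W T i"
  define slope where "slope k = (e (t (k + 1)) - e (t k)) / (t (k + 1) - t k)" for k
  define R where "R k = (if k < n \<and> t k < t (k + 1) then l * (deriv e (t k) - slope k) else 0)" for k
  define L where "L k = (if k < n \<and> t k < t (k + 1) then l * (slope k - deriv e (t (k + 1))) else 0)" for k
  have l: "l \<noteq> 0"
    using T i by (simp add: l_def eigval_W_def)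
  have gap: "((\<lambda>s. w s * e s) has_integral R k * w (t k) + L k * w (t (Suc k))) {t k..t (Suc k)}"
    if k: "k < n" for k
  proof (cases "t k < t (k + 1)")
    case True
    have "((\<lambda>s. w s * e s) has_integral
      l * (w (t k) * (deriv e (t k) - slope k) + w (t (k + 1)) * (slope k - deriv e (t (k + 1)))))
      {t k..t (k + 1)}"
      unfolding slope_def using True l w[OF k] eigfun_W_derivatives[of T i] T i
      by (intro has_integral_affine_times_eigenfunction) (simp_all add: e_def l_def)
    then show ?thesis
      using True k by (simp add: R_def L_def algebra_simps)
  next
    case False
    then have "t (Suc k) = t k"
      using t(3)[OF k] by simp
    then show ?thesis
      by (simp add: R_def L_def has_integral_refl)
  qed
  have "((\<lambda>s. w s * e s) has_integral (\<Sum>k<n. R k * w (t k) + L k * w (t (Suc k)))) {t 0..t n}"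
    using gap t(3) by (intro has_integral_consecutive_intervals) auto
  moreover have "(\<Sum>k<n. R k * w (t k) + L k * w (t (Suc k))) = (\<Sum>j=0..n. alpha_W T n t i j * w (t j))"
  proof -
    have alpha_0: "alpha_W T n t i 0 = R 0"
      using n t(3)[of 0] unfolding alpha_W_def R_def slope_def e_def[symmetric] l_def[symmetric]
      by auto
    have alpha_n: "alpha_W T n t i n = L (n - 1)"
      using n t(3)[of "n - 1"] unfolding alpha_W_def L_def slope_def e_def[symmetric] l_def[symmetric]
      by auto
    have alpha_mid: "alpha_W T n t i (Suc k) = R (Suc k) + L k" if "Suc k < n" for k
    proof -
      let ?a = "t k" and ?b = "t (Suc k)" and ?c = "t (Suc (Suc k))"
      have "?a \<le> ?b" "?b \<le> ?c"
        using t(3)[of k] t(3)[of "Suc k"] that by auto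
      moreover have "l * (((?c - ?a) * e ?b - (?c - ?b) * e ?a - (?b - ?a) * e ?c) / ((?c - ?b) * (?b - ?a)))
        = l * (deriv e ?b - (e ?c - e ?b) / (?c - ?b)) + l * ((e ?b - e ?a) / (?b - ?a) - deriv e ?b)"
        if "?a < ?b" "?b < ?c"
      proof -
        have "((?c - ?a) * e ?b - (?c - ?b) * e ?a - (?b - ?a) * e ?c) / ((?c - ?b) * (?b - ?a))
          = (e ?b - e ?a) / (?b - ?a) - (e ?c - e ?b) / (?c - ?b)" (is "?lhs = ?S - ?S'")
          using that by (simp add: divide_simps) (simp add: algebra_simps)
        moreover have "l * (?S - ?S') = l * (deriv e ?b - ?S') + l * (?S - deriv e ?b)"
          by (simp only: right_diff_distrib)
        ultimately show ?thesis
          by (simp only:)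
      qed
      ultimately show ?thesis
        using that unfolding alpha_W_def R_def L_def slope_def e_def[symmetric] l_def[symmetric]
        by (auto simp: Let_def)
    qed
    have n': "n = Suc (n - 1)"
      using n by simp
    have "(\<Sum>j=0..n. alpha_W T n t i j * w (t j))
      = alpha_W T n t i 0 * w (t 0) + (\<Sum>k<n. alpha_W T n t i (Suc k) * w (t (Suc k)))"
      by (simp add: atLeast0AtMost sum.atMost_shift)
    also have "(\<Sum>k<n. alpha_W T n t i (Suc k) * w (t (Suc k)))
      = (\<Sum>k<n. (R (Suc k) + L k) * w (t (Suc k)))"
    proof (intro sum.cong refl)
      fix k assume "k \<in> {..<n}"
      then consider "Suc k < n" | "Suc k = n" by force
      then show "alpha_W T n t i (Suc k) * w (t (Suc k)) = (R (Suc k) + L k) * w (t (Suc k))"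
      proof cases
        case 1
        then show ?thesis by (simp add: alpha_mid)
      next
        case 2
        then have "k = n - 1" by simp
        have "R n = 0" by (simp add: R_def)
        then show ?thesis
          using 2 alpha_n \<open>k = n - 1\<close> by simp
      qed
    qed
    also have "alpha_W T n t i 0 * w (t 0) + \<dots>
      = (R 0 * w (t 0) + (\<Sum>k<n. R (Suc k) * w (t (Suc k)))) + (\<Sum>k<n. L k * w (t (Suc k)))"
      by (simp add: alpha_0 distrib_right sum.distrib)
    also have "R 0 * w (t 0) + (\<Sum>k<n. R (Suc k) * w (t (Suc k))) = (\<Sum>k<Suc n. R k * w (t k))"
      by (simp only: sum.lessThan_Suc_shift)
    also have "\<dots> = (\<Sum>k<n. R k * w (t k))"
      by (simp add: R_def)
    finally show ?thesis
      by (simp add: sum.distrib)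
  qed
  ultimately show ?thesis
    using t unfolding e_def by simp
qed

section \<open>Brownian motion between the observation times\<close>

lemma observation_times_in_range:
  fixes t :: "nat \<Rightarrow> real"
  assumes "t 0 = 0" "t n = T" "\<And>j. j < n \<Longrightarrow> t j \<le> t (j + 1)" and "j \<le> n"
  shows "t j \<in> {0..T}"
proof -
  have "t i \<le> t j" if "i \<le> j" "j \<le> n" for i j
    using that
  proof (induction j)
    case (Suc j)
    then show ?case
      using assms(3)[of j] by (cases "i = Suc j") force+
  qed simp
  from this[of 0 j] this[of j n] show ?thesis
    using assms by simp
qed

context standard_brownian_motion
begin

text \<open>
  A path is the limit of its step functions on the grids \<open>\<int> / N\<close>, which take only countably many
  values in time. Clamping the time to \<open>[0, T]\<close> yields a function on the whole line.
\<close>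
lemma path_jointly_measurable:
  assumes "0 \<le> T"
  shows "(\<lambda>(s, \<omega>). W (max 0 (min T s)) \<omega>) \<in> borel_measurable (borel \<Otimes>\<^sub>M M)"
proof -
  define p where "p N s = max 0 (min T (real_of_int \<lfloor>real (Suc N) * s\<rfloor> / real (Suc N)))" for N s
  have range: "max 0 (min T s) \<in> {0..T}" for s
    using assms by auto
  have "(\<lambda>x. W (p N (fst x)) (snd x)) \<in> borel_measurable (borel \<Otimes>\<^sub>M M)" for N
    unfolding p_def
  proof (rule measurable_compose_countable
      [where f = "\<lambda>k x. W (max 0 (min T (real_of_int k / real (Suc N)))) (snd x)"
         and g = "\<lambda>x. \<lfloor>real (Suc N) * fst x\<rfloor>"])
    show "(\<lambda>x. W (max 0 (min T (real_of_int k / real (Suc N)))) (snd x)) \<in> borel_measurable (borel \<Otimes>\<^sub>M M)" for k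
      using measurable_compose[OF measurable_snd measurable_W[OF range]] by simp
  qed measurable
  moreover have "(\<lambda>N. W (p N (fst x)) (snd x)) \<longlonglongrightarrow> W (max 0 (min T (fst x))) (snd x)"
    if "x \<in> space (borel \<Otimes>\<^sub>M M)" for x
  proof -
    have "(\<lambda>N. real_of_int \<lfloor>real (Suc N) * s\<rfloor> / real (Suc N)) \<longlonglongrightarrow> s" for s
    proof (rule tendsto_sandwich)
      have "s - 1 / real (Suc N) \<le> real_of_int \<lfloor>real (Suc N) * s\<rfloor> / real (Suc N)" for N
      proof -
        have "(real (Suc N) * s - 1) / real (Suc N) \<le> real_of_int \<lfloor>real (Suc N) * s\<rfloor> / real (Suc N)"
          by (intro divide_right_mono) linarith+
        then show ?thesis by (simp add: diff_divide_distrib)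
      qed
      then show "\<forall>\<^sub>F N in sequentially. s - 1 / real (Suc N) \<le> real_of_int \<lfloor>real (Suc N) * s\<rfloor> / real (Suc N)"
        by simp
      have "real_of_int \<lfloor>real (Suc N) * s\<rfloor> / real (Suc N) \<le> s" for N
        by (subst pos_divide_le_eq) (auto simp: mult.commute)
      then show "\<forall>\<^sub>F N in sequentially. real_of_int \<lfloor>real (Suc N) * s\<rfloor> / real (Suc N) \<le> s"
        by simp
      show "(\<lambda>N. s - 1 / real (Suc N)) \<longlonglongrightarrow> s"
        using tendsto_diff[OF tendsto_const LIMSEQ_Suc[OF lim_1_over_n], of s] by simp
    qed simp
    then have "(\<lambda>N. p N (fst x)) \<longlonglongrightarrow> max 0 (min T (fst x))"
      unfolding p_def by (intro tendsto_intros)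
    moreover have "snd x \<in> space M"
      using that by (auto simp: space_pair_measure)
    ultimately show ?thesis
      using range by (intro continuous_on_tendsto_compose[OF continuous_paths]) (auto simp: p_def)
  qed
  ultimately have "(\<lambda>x. W (max 0 (min T (fst x))) (snd x)) \<in> borel_measurable (borel \<Otimes>\<^sub>M M)"
    by (rule borel_measurable_LIMSEQ_real[rotated])
  then show ?thesis
    by (simp add: case_prod_beta')
qed

lemma integrable_W:
  assumes s: "s \<in> {0..T}"
  shows "integrable M (W s)" and "(\<integral>\<omega>. \<bar>W s \<omega>\<bar> \<partial>M) \<le> sqrt T"
proof -
  have [measurable]: "W s \<in> borel_measurable M" "W 0 \<in> borel_measurable M"
    using s by (auto intro: measurable_W)
  have "integrable M (W s) \<and> (\<integral>\<omega>. \<bar>W s \<omega>\<bar> \<partial>M) \<le> sqrt T"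
  proof (cases "s = 0")
    case True
    have "integrable M (W s)"
      using start_zero True by (subst integrable_cong_AE[where g = "\<lambda>_. 0"]) auto
    moreover have "(\<integral>\<omega>. \<bar>W s \<omega>\<bar> \<partial>M) = (\<integral>\<omega>. 0 \<partial>M)"
      using start_zero True by (intro integral_cong_AE) auto
    ultimately show ?thesis
      using s by simp
  next
    case False
    then have D: "distributed M lborel (\<lambda>\<omega>. W s \<omega> - W 0 \<omega>) (normal_density 0 (sqrt s))"
      using normal_increments[of 0 s] s by simp
    have "AE \<omega> in M. W s \<omega> = W s \<omega> - W 0 \<omega>"
      using start_zero by eventually_elim simp
    have s0: "sqrt s > 0"
      using s False by simp
    note moments = centred_normal_first_moments[OF D s0]
    have "integrable M (W s)"
      using moments(1) \<open>AE \<omega> in M. W s \<omega> = W s \<omega> - W 0 \<omega>\<close>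
      by (subst integrable_cong_AE) auto
    moreover have "(\<integral>\<omega>. \<bar>W s \<omega>\<bar> \<partial>M) = (\<integral>\<omega>. \<bar>W s \<omega> - W 0 \<omega>\<bar> \<partial>M)"
      using start_zero by (intro integral_cong_AE) auto
    moreover have "sqrt s * sqrt (2 / pi) \<le> sqrt T * 1"
      using s pi_ge_two by (intro mult_mono) auto
    ultimately show ?thesis
      using moments(2) by simp
  qed
  then show "integrable M (W s)" and "(\<integral>\<omega>. \<bar>W s \<omega>\<bar> \<partial>M) \<le> sqrt T"
    by auto
qed

text \<open>
  Fubini applies because \<open>E \<bar>W\<^sub>s\<bar>\<close> is bounded on \<open>[0, T]\<close>.
\<close>
lemma path_integral_Fubini:
  fixes c :: "real \<Rightarrow> real"
  assumes T: "0 \<le> T" and c: "continuous_on UNIV c" "\<And>s. \<bar>c s\<bar> \<le> K"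
    and A: "A \<in> sets M"
  shows "integrable M (\<lambda>\<omega>. LBINT s:{0..T}. W s \<omega> * c s)"
    and "set_integrable lborel {0..T} (\<lambda>s. (\<integral>\<omega>. indicator A \<omega> * W s \<omega> \<partial>M) * c s)"
    and "(\<integral>\<omega>. indicator A \<omega> * (LBINT s:{0..T}. W s \<omega> * c s) \<partial>M)
      = (LBINT s:{0..T}. (\<integral>\<omega>. indicator A \<omega> * W s \<omega> \<partial>M) * c s)"
proof -
  interpret pair_sigma_finite lborel M ..
  define F where "F s \<omega> = indicator {0..T} s * (W (max 0 (min T s)) \<omega> * c s)" for s \<omega>
  have [measurable]: "c \<in> borel_measurable borel"
    using c(1) by (rule borel_measurable_continuous_onI)
  note [measurable] = path_jointly_measurable[OF T] A
  have F[measurable]: "case_prod F \<in> borel_measurable (lborel \<Otimes>\<^sub>M M)"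
    unfolding F_def using path_jointly_measurable[OF T] by measurable
  have F_eq: "F s \<omega> = indicator {0..T} s * (W s \<omega> * c s)" for s \<omega>
    by (auto simp: F_def split: split_indicator)
  have int_s: "integrable M (F s)" for s
    unfolding F_eq using integrable_W(1)[of s] by (cases "s \<in> {0..T}") auto
  have F_int: "integrable (lborel \<Otimes>\<^sub>M M) (case_prod F)"
  proof (rule Fubini_integrable)
    show "case_prod F \<in> borel_measurable (lborel \<Otimes>\<^sub>M M)" by fact
    show "AE s in lborel. integrable M (\<lambda>\<omega>. case_prod F (s, \<omega>))"
      using int_s by simp
    have bound: "(\<integral>\<omega>. \<bar>F s \<omega>\<bar> \<partial>M) \<le> indicator {0..T} s * (sqrt T * K)" for s
    proof (cases "s \<in> {0..T}")
      case True
      have "(\<integral>\<omega>. \<bar>F s \<omega>\<bar> \<partial>M) = (\<integral>\<omega>. \<bar>W s \<omega>\<bar> \<partial>M) * \<bar>c s\<bar>"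
        using True by (simp add: F_eq abs_mult)
      also have "\<dots> \<le> sqrt T * K"
        using integrable_W(2)[OF True] c(2)[of s] T by (intro mult_mono) auto
      finally show ?thesis using True by simp
    qed (simp add: F_eq)
    show "integrable lborel (\<lambda>s. \<integral>\<omega>. norm (case_prod F (s, \<omega>)) \<partial>M)"
    proof (rule Bochner_Integration.integrable_bound)
      show "integrable lborel (\<lambda>s. indicator {0..T} s * (sqrt T * K))"
        using T by (intro integrable_mult_left integrable_real_indicator) simp_all
      show "(\<lambda>s. \<integral>\<omega>. norm (case_prod F (s, \<omega>)) \<partial>M) \<in> borel_measurable lborel"
        by measurable
      show "AE s in lborel. norm (\<integral>\<omega>. norm (case_prod F (s, \<omega>)) \<partial>M)
          \<le> norm (indicator {0..T} s * (sqrt T * K))"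
      proof (rule AE_I2)
        fix s
        have "norm (\<integral>\<omega>. norm (case_prod F (s, \<omega>)) \<partial>M) = (\<integral>\<omega>. \<bar>F s \<omega>\<bar> \<partial>M)"
          by simp
        then show "norm (\<integral>\<omega>. norm (case_prod F (s, \<omega>)) \<partial>M) \<le> norm (indicator {0..T} s * (sqrt T * K))"
          using bound[of s] by (simp only: real_norm_def)
      qed
    qed
  qed
  then have "integrable M (\<lambda>\<omega>. \<integral>s. F s \<omega> \<partial>lborel)"
    by (rule integrable_snd)
  then show "integrable M (\<lambda>\<omega>. LBINT s:{0..T}. W s \<omega> * c s)"
    by (simp add: F_eq set_lebesgue_integral_def)
  have FA: "integrable (lborel \<Otimes>\<^sub>M M) (\<lambda>(s, \<omega>). indicator A \<omega> * F s \<omega>)"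
    using F_int
    by (rule Bochner_Integration.integrable_bound) (auto split: split_indicator)
  have E: "(\<integral>\<omega>. indicator A \<omega> * F s \<omega> \<partial>M)
    = indicator {0..T} s * ((\<integral>\<omega>. indicator A \<omega> * W s \<omega> \<partial>M) * c s)" for s
  proof -
    have "(\<integral>\<omega>. indicator A \<omega> * F s \<omega> \<partial>M)
      = (\<integral>\<omega>. (indicator {0..T} s * c s) * (indicator A \<omega> * W s \<omega>) \<partial>M)"
      by (simp add: F_eq mult_ac)
    then show ?thesis by simp
  qed
  show "set_integrable lborel {0..T} (\<lambda>s. (\<integral>\<omega>. indicator A \<omega> * W s \<omega> \<partial>M) * c s)"
    using integrable_fst'[OF FA] by (simp add: E set_integrable_def)
  have "(\<integral>\<omega>. indicator A \<omega> * (LBINT s:{0..T}. W s \<omega> * c s) \<partial>M)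
    = (\<integral>\<omega>. (\<integral>s. indicator A \<omega> * F s \<omega> \<partial>lborel) \<partial>M)"
    by (simp add: F_eq set_lebesgue_integral_def)
  also have "\<dots> = (\<integral>s. (\<integral>\<omega>. indicator A \<omega> * F s \<omega> \<partial>M) \<partial>lborel)"
    using Fubini_integral[OF FA] .
  also have "\<dots> = (LBINT s:{0..T}. (\<integral>\<omega>. indicator A \<omega> * W s \<omega> \<partial>M) * c s)"
    by (simp add: E set_lebesgue_integral_def)
  finally show "(\<integral>\<omega>. indicator A \<omega> * (LBINT s:{0..T}. W s \<omega> * c s) \<partial>M)
      = (LBINT s:{0..T}. (\<integral>\<omega>. indicator A \<omega> * W s \<omega> \<partial>M) * c s)" .
qed

text \<open>
  Inserting \<open>s\<close> into the observation grid splits one increment into \<open>X\<close> and \<open>Y\<close>. As \<open>W\<close> starts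
  at zero almost surely, every observation is a partial sum of the increments of the refined grid,
  and \<open>X\<close> and \<open>Y\<close> enter it only through \<open>X + Y\<close>.
\<close>
lemma brownian_bridge_centred_given_observations:
  assumes t: "t 0 = 0" "t n = T" "\<And>j. j < n \<Longrightarrow> t j \<le> t (j + 1)"
    and k: "k < n" and s: "s \<in> {t k..t (k + 1)}"
    and A: "A \<in> sets (sigma_observations M W t n)"
  defines "w \<equiv> \<lambda>s. \<integral>\<omega>. indicator A \<omega> * W s \<omega> \<partial>M"
  shows "(t (k + 1) - t k) * w s = (t (k + 1) - s) * w (t k) + (s - t k) * w (t (k + 1))"
proof -
  consider "s = t k" | "s = t (k + 1)" | "t k < s" "s < t (k + 1)"
    using s by fastforce
  then show ?thesis
  proof cases
    case 3
    have t_range: "t j \<in> {0..T}" if "j \<le> n" for j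
      using observation_times_in_range[OF t that] .
    define r where "r m = (if m \<le> k then t m else if m = Suc k then s else t (m - 1))" for m
    have s_range: "s \<in> {0..T}"
      using 3 t_range[of k] t_range[of "k + 1"] k by auto
    have r_range: "r m \<in> {0..T}" if "m \<le> Suc n" for m
      using t_range that s_range k unfolding r_def by (auto simp: le_diff_conv)
    have r_mono: "r m \<le> r (Suc m)" if "m < Suc n" for m
    proof -
      consider "m < k" | "m = k" | "m = Suc k" | "m > Suc k"
        by linarith
      then show ?thesis
        using that 3 k t(3)[of m] t(3)[of "m - 1"] unfolding r_def
        by cases auto
    qed
    define D where "D m \<omega> = W (r (Suc m)) \<omega> - W (r m) \<omega>" for m \<omega>
    have D: "indep_vars (\<lambda>_. borel) D {..<Suc n}"
      unfolding D_def using r_range r_mono by (intro indep_increments) auto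
    have D_rv[measurable]: "D m \<in> borel_measurable M" if "m < Suc n" for m
      using D that by (auto simp: indep_vars_def)
    let ?I = "{k, Suc k}" and ?J = "{..<Suc n} - {k, Suc k}"
    define V where "V \<omega> = (\<lambda>m\<in>?I. D m \<omega>)" for \<omega>
    define Z where "Z \<omega> = (\<lambda>m\<in>?J. D m \<omega>)" for \<omega>
    have VZ: "indep_var (PiM ?I (\<lambda>_. borel)) V (PiM ?J (\<lambda>_. borel)) Z"
      unfolding V_def Z_def using k by (intro indep_var_restrict[OF D]) auto
    have "indep_var borel ((\<lambda>p. p k) \<circ> (\<lambda>\<omega>. \<lambda>m\<in>{k}. D m \<omega>))
        borel ((\<lambda>p. p (Suc k)) \<circ> (\<lambda>\<omega>. \<lambda>m\<in>{Suc k}. D m \<omega>))"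
      using k by (intro indep_var_compose[OF indep_var_restrict[OF D]] measurable_component_singleton) auto
    then have XY: "indep_var borel (D k) borel (D (Suc k))"
      by (simp add: comp_def)
    define u v where "u = s - t k" and "v = t (k + 1) - s"
    have uv: "u > 0" "v > 0"
      using 3 by (simp_all add: u_def v_def)
    have X: "distributed M lborel (D k) (normal_density 0 (sqrt u))"
      using normal_increments[of "t k" s] 3 t_range[of k] s_range k
      by (simp add: D_def[abs_def] r_def u_def)
    have Y: "distributed M lborel (D (Suc k)) (normal_density 0 (sqrt v))"
      using normal_increments[of s "t (k + 1)"] 3 t_range[of "k + 1"] s_range k
      by (simp add: D_def[abs_def] r_def v_def)
    define f where "f p = v * p k - u * p (Suc k)" for p :: "nat \<Rightarrow> real"
    define g where "g p = p k + p (Suc k)" for p :: "nat \<Rightarrow> real"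
    have [measurable]: "f \<in> borel_measurable (PiM ?I (\<lambda>_. borel))"
      "g \<in> borel_measurable (PiM ?I (\<lambda>_. borel))"
      unfolding f_def g_def by measurable
    have fV: "f (V \<omega>) = v * D k \<omega> - u * D (Suc k) \<omega>" and gV: "g (V \<omega>) = D k \<omega> + D (Suc k) \<omega>" for \<omega>
      by (simp_all add: f_def g_def V_def)
    \<comment> \<open>The map that rebuilds the observations from the sum \<open>X + Y\<close> and the other increments:
      \<open>t\<^sub>j\<close> has index \<open>j\<close> in the refined grid if it lies to the left of \<open>s\<close>, and \<open>Suc j\<close>
      otherwise.\<close>
    define h where "h q = (\<lambda>j\<in>{0..n}. (\<Sum>m\<in>{..<if j \<le> k then j else Suc j} - ?I. snd q m)
      + (if j \<le> k then 0 else fst q))" for q :: "real \<times> (nat \<Rightarrow> real)"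
    have h: "h \<in> measurable (borel \<Otimes>\<^sub>M PiM ?J (\<lambda>_. borel)) (PiM {0..n} (\<lambda>_. borel))"
      unfolding h_def
    proof (intro measurable_restrict borel_measurable_add borel_measurable_sum)
      fix j m assume "j \<in> {0..n}" "m \<in> {..<if j \<le> k then j else Suc j} - ?I"
      then have "m \<in> ?J"
        using k by (auto split: if_splits)
      then show "(\<lambda>q. snd q m) \<in> borel_measurable (borel \<Otimes>\<^sub>M PiM ?J (\<lambda>_. borel :: real measure))"
        by measurable
    qed simp
    have obs: "h (g (V \<omega>), Z \<omega>) = (\<lambda>j\<in>{0..n}. W (t j) \<omega>)" if W0: "W 0 \<omega> = 0" for \<omega>
    proof -
      have "(\<Sum>m\<in>{..<if j \<le> k then j else Suc j} - ?I. Z \<omega> m) + (if j \<le> k then 0 else g (V \<omega>)) = W (t j) \<omega>"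
        if j: "j \<in> {0..n}" for j
      proof -
        let ?q = "if j \<le> k then j else Suc j"
        have "(\<Sum>m\<in>{..<?q} - ?I. Z \<omega> m) = (\<Sum>m\<in>{..<?q} - ?I. D m \<omega>)"
          using j k by (intro sum.cong) (auto simp: Z_def split: if_splits)
        moreover have "(if j \<le> k then 0 else g (V \<omega>)) = (\<Sum>m\<in>{..<?q} \<inter> ?I. D m \<omega>)"
        proof (cases "j \<le> k")
          case False
          then have "{..<?q} \<inter> ?I = ?I" by auto
          then show ?thesis using False by (simp add: gV)
        next
          case True
          then have "{..<?q} \<inter> ?I = {}" by auto
          then show ?thesis using True by simp
        qed
        moreover have "(\<Sum>m\<in>{..<?q} - ?I. D m \<omega>) + (\<Sum>m\<in>{..<?q} \<inter> ?I. D m \<omega>) = (\<Sum>m<?q. D m \<omega>)"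
          by (subst sum.Int_Diff[of "{..<?q}" _ ?I]) (auto simp: add.commute)
        moreover have "(\<Sum>m<?q. D m \<omega>) = W (r ?q) \<omega> - W (r 0) \<omega>"
          unfolding D_def by (rule sum_lessThan_telescope)
        moreover have "r ?q = t j" "r 0 = 0"
          using t(1) by (auto simp: r_def)
        ultimately show ?thesis
          using W0 by simp
      qed
      then show ?thesis
        unfolding h_def fst_conv snd_conv by (intro restrict_ext)
    qed
    \<comment> \<open>Up to the null event \<open>W\<^sub>0 \<noteq> 0\<close>, \<open>A\<close> is determined by the arguments of \<open>h\<close>.\<close>
    have "(\<lambda>\<omega>. \<lambda>j\<in>{0..n}. W (t j) \<omega>) \<in> space M \<rightarrow> space (PiM {0..n} (\<lambda>_. borel))"
      by (auto simp: space_PiM)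
    then obtain B where B: "B \<in> sets (PiM {0..n} (\<lambda>_. borel))"
      and A_eq: "A = (\<lambda>\<omega>. \<lambda>j\<in>{0..n}. W (t j) \<omega>) -` B \<inter> space M"
      using A unfolding sigma_observations_def by (auto simp: sets_vimage_algebra2)
    define C where "C = h -` B \<inter> space (borel \<Otimes>\<^sub>M PiM ?J (\<lambda>_. borel))"
    have C: "C \<in> sets (borel \<Otimes>\<^sub>M PiM ?J (\<lambda>_. borel))"
      unfolding C_def using h B by (rule measurable_sets)
    have A_C: "indicator A \<omega> = (indicator C (g (V \<omega>), Z \<omega>) :: real)"
      if "\<omega> \<in> space M" "W 0 \<omega> = 0" for \<omega>
      using that obs[OF that(2)] by (auto simp: A_eq C_def space_pair_measure space_PiM Z_def indicator_def)
    have V[measurable]: "V \<in> measurable M (PiM ?I (\<lambda>_. borel))" and Z[measurable]: "Z \<in> measurable M (PiM ?J (\<lambda>_. borel))"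
      using indep_var_rv1[OF VZ] indep_var_rv2[OF VZ] by auto
    have int_f: "integrable M (\<lambda>\<omega>. f (V \<omega>))"
      unfolding fV using centred_normal_first_moments(1)[OF X] centred_normal_first_moments(1)[OF Y] uv
      by auto
    have "(\<integral>\<omega>. f (V \<omega>) * indicator C (g (V \<omega>), Z \<omega>) \<partial>M) = 0"
      using VZ _ _ int_f _ C
    proof (rule centred_given_independent)
      fix B :: "real set" assume "B \<in> sets borel"
      then show "(\<integral>\<omega>. f (V \<omega>) * indicator B (g (V \<omega>)) \<partial>M) = 0"
        unfolding fV gV by (rule gaussian_bridge_centred_on_sum[OF XY uv X Y])
    qed measurable
    have A_M[measurable]: "A \<in> sets M"
    proof -
      have "(\<lambda>\<omega>. \<lambda>j\<in>{0..n}. W (t j) \<omega>) \<in> measurable M (PiM {0..n} (\<lambda>_. borel))"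
        using t_range by (intro measurable_restrict measurable_W) auto
      then show ?thesis
        unfolding A_eq using B by (rule measurable_sets)
    qed
    have int_A: "integrable M (\<lambda>\<omega>. indicator A \<omega> * W x \<omega>)" if "x \<in> {0..T}" for x
      using integrable_real_mult_indicator[OF A_M integrable_W(1)[OF that]] by (simp add: mult.commute)
    have "0 = (\<integral>\<omega>. f (V \<omega>) * indicator C (g (V \<omega>), Z \<omega>) \<partial>M)"
      using \<open>(\<integral>\<omega>. f (V \<omega>) * indicator C (g (V \<omega>), Z \<omega>) \<partial>M) = 0\<close> by simp
    also have "\<dots> = (\<integral>\<omega>. f (V \<omega>) * indicator A \<omega> \<partial>M)"
    proof (rule integral_cong_AE)
      show "AE \<omega> in M. f (V \<omega>) * indicator C (g (V \<omega>), Z \<omega>) = f (V \<omega>) * indicator A \<omega>"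
        using start_zero AE_space by eventually_elim (simp add: A_C)
    qed (use C in measurable)
    also have "\<dots> = (\<integral>\<omega>. (t (k + 1) - t k) * (indicator A \<omega> * W s \<omega>)
      - (v * (indicator A \<omega> * W (t k) \<omega>) + u * (indicator A \<omega> * W (t (k + 1)) \<omega>)) \<partial>M)"
      unfolding fV by (simp add: D_def r_def u_def v_def algebra_simps)
    also have "\<dots> = (t (k + 1) - t k) * w s - (v * w (t k) + u * w (t (k + 1)))"
      using int_A t_range s_range k unfolding w_def by simp
    finally show ?thesis
      by (simp add: u_def v_def)
  qed (auto simp: algebra_simps)
qed

end

section \<open>The conditional expectation\<close>

theorem mainTheorem6:
  fixes M :: "'a measure" and T :: real and W :: "real \<Rightarrow> 'a \<Rightarrow> real"
    and n i :: nat and t :: "nat \<Rightarrow> real"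
  assumes "T > 0"
    and "standard_brownian_motion M T W"
    and "n \<ge> 1"
    and "t 0 = 0"
    and "\<And>j. j < n \<Longrightarrow> t j \<le> t (j + 1)"
    and "t n = T"
    and "i \<ge> 1"
  shows "AE \<omega> in M.
    real_cond_exp M (sigma_observations M W t n)
      (\<lambda>\<omega>'. LBINT s:{0..T}. W s \<omega>' * eigfun_W T i s) \<omega>
    = (\<Sum>j=0..n. alpha_W T n t i j * W (t j) \<omega>)"
proof -
  interpret standard_brownian_motion M T W by fact
  let ?F = "sigma_observations M W t n" and ?e = "eigfun_W T i"
  let ?obs = "\<lambda>\<omega>. \<lambda>j\<in>{0..n}. W (t j) \<omega>"
  have T: "0 \<le> T"
    using assms(1) by simp
  have t_range: "t j \<in> {0..T}" if "j \<le> n" for j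
    using observation_times_in_range[OF assms(4,6,5) that] .
  have W_t[measurable]: "W (t j) \<in> borel_measurable M" if "j \<le> n" for j
    using measurable_W t_range that by blast
  have subalg: "subalgebra M ?F"
    unfolding subalgebra_def sigma_observations_def
    by (intro conjI sets_image_in_sets measurable_restrict) (auto intro: W_t)
  interpret F: finite_measure_subalgebra M ?F
    by unfold_locales (rule subalg)
  have e: "continuous_on UNIV ?e"
    unfolding eigfun_W_def using assms(1) by (intro continuous_intros) auto
  have e_bound: "\<bar>?e s\<bar> \<le> sqrt (2 / T)" for s
  proof -
    have "\<bar>?e s\<bar> = sqrt (2 / T) * \<bar>sin (pi * (real i - 1 / 2) * (s / T))\<bar>"
      using T by (simp add: eigfun_W_def abs_mult)
    also have "\<dots> \<le> sqrt (2 / T) * 1"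
      using T by (intro mult_left_mono) auto
    finally show ?thesis by simp
  qed
  note Fubini = path_integral_Fubini[OF T e e_bound]
  have int_sum: "integrable M (\<lambda>\<omega>. \<Sum>j=0..n. alpha_W T n t i j * W (t j) \<omega>)"
    using integrable_W(1)[OF t_range] by (intro Bochner_Integration.integrable_sum) simp
  show ?thesis
  proof (rule F.real_cond_exp_charact)
    fix A assume A: "A \<in> sets ?F"
    then have [measurable]: "A \<in> sets M"
      using subalg by (auto simp: subalgebra_def)
    define w where "w s = (\<integral>\<omega>. indicator A \<omega> * W s \<omega> \<partial>M)" for s
    have "((\<lambda>s. w s * ?e s) has_integral (\<Sum>j=0..n. alpha_W T n t i j * w (t j))) {0..T}"
      using assms brownian_bridge_centred_given_observations[OF assms(4,6,5) _ _ A]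
      unfolding w_def by (intro alpha_W_quadrature) auto
    moreover have "set_integrable lborel {0..T} (\<lambda>s. w s * ?e s)"
      unfolding w_def by (rule Fubini(2)) measurable
    ultimately have quadrature: "(LBINT s:{0..T}. w s * ?e s) = (\<Sum>j=0..n. alpha_W T n t i j * w (t j))"
      by (simp add: set_borel_integral_eq_integral(2) integral_unique)
    have int_A: "integrable M (\<lambda>\<omega>. indicator A \<omega> * W (t j) \<omega>)" if "j \<le> n" for j
      using integrable_real_mult_indicator[OF \<open>A \<in> sets M\<close> integrable_W(1)[OF t_range[OF that]]]
      by (simp add: mult.commute)
    have "(\<integral>\<omega>\<in>A. (LBINT s:{0..T}. W s \<omega> * ?e s) \<partial>M) = (LBINT s:{0..T}. w s * ?e s)"
      using Fubini(3)[of A] by (simp add: set_lebesgue_integral_def w_def)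
    also have "\<dots> = (\<Sum>j=0..n. alpha_W T n t i j * w (t j))"
      by (rule quadrature)
    also have "\<dots> = (\<integral>\<omega>. (\<Sum>j=0..n. alpha_W T n t i j * (indicator A \<omega> * W (t j) \<omega>)) \<partial>M)"
      unfolding w_def using int_A by (subst Bochner_Integration.integral_sum) auto
    also have "\<dots> = (\<integral>\<omega>\<in>A. (\<Sum>j=0..n. alpha_W T n t i j * W (t j) \<omega>) \<partial>M)"
      by (simp add: set_lebesgue_integral_def sum_distrib_left mult_ac)
    finally show "(\<integral>\<omega>\<in>A. (LBINT s:{0..T}. W s \<omega> * ?e s) \<partial>M)
      = (\<integral>\<omega>\<in>A. (\<Sum>j=0..n. alpha_W T n t i j * W (t j) \<omega>) \<partial>M)" .
  next
    show "integrable M (\<lambda>\<omega>. LBINT s:{0..T}. W s \<omega> * ?e s)"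
      by (rule Fubini(1)[of "{}"]) simp
  next
    have obs: "?obs \<in> measurable ?F (PiM {0..n} (\<lambda>_. borel))"
      unfolding sigma_observations_def by (rule measurable_vimage_algebra1) (auto simp: space_PiM)
    have "W (t j) \<in> borel_measurable ?F" if "j \<in> {0..n}" for j
      using measurable_compose[OF obs measurable_component_singleton[OF that]] that by simp
    then show "(\<lambda>\<omega>. \<Sum>j=0..n. alpha_W T n t i j * W (t j) \<omega>) \<in> borel_measurable ?F"
      by (intro borel_measurable_sum borel_measurable_times) auto
  qed (rule int_sum)
qed

end
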